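(* Let $r,s,k$ be integers with $0\le r,s\le k$. If $r\le s$, then as formal power series \[ \sum_{n\ge0}\mu^{\le k}_{n,r,s}x^n=\frac{P^*_r(x)\,\delta^{s+1}P^*_{k-s}(x)}{P^*_{k+1}(x)}\cdot x^{s-r}. \] If $r>s$, then \[ \sum_{n\ge0}\mu^{\le k}_{n,r,s}x^n=\frac{P^*_s(x)\,\delta^{r+1}P^*_{k-r}(x)}{P^*_{k+1}(x)}\cdot\prod_{i=s+1}^{r}(a_i+\lambda_ix). \]
   Context: Let $b=\{b_n\}_{n\ge0}$, $a=\{a_n\}_{n\ge0}$, $\lambda=\{\lambda_n\}_{n\ge0}$ be sequences of complex numbers. Let $P_n(x)=P_n(x;b,a,\lambda)$ be defined by $P_{-1}=0$, $P_0=1$, $P_{n+1}(x)=(x-b_n)P_n(x)-(a_nx+\lambda_n)P_{n-1}(x)$, and let $P^*_n(x)=P^*_n(x;b,a,\lambda)=x^nP_n(1/x)$ (so $P^*_n(0)=1$). For a sequence $s=\{s_n\}_{n\ge0}$ let $\delta s=\{s_{n+1}\}_{n\ge0}$, and $\delta^jP^*_n(x)=P^*_n(x;\delta^jb,\delta^ja,\delta^j\lambda)$. A Motzkin–Schröder path is a lattice path never going below the $x$-axis with steps up $(1,1)$, horizontal $(1,0)$, vertical down $(0,-1)$, diagonal down $(1,-1)$; its weight is the product of step weights, where up steps have weight $1$, a horizontal step starting at height $h$ has weight $b_h$, a vertical down step starting at height $h$ has weight $a_h$, and a diagonal down step starting at height $h$ has weight $\lambda_h$. Let $\mu^{\le k}_{n,r,s}$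 be the sum of weights of all Motzkin–Schröder paths from $(0,r)$ to $(n,s)$ all of whose points have $y$-coordinate at most $k$. *)

theory Defs
  imports Complex_Main "HOL-Computational_Algebra.Computational_Algebra"
begin

text \<open>The polynomials \<open>P\<^sub>n(x; b, a, \<lambda>)\<close>. The clause for index 1 is the recurrence at
  \<open>n = 0\<close>, where the second term vanishes because \<open>P\<^sub>-\<^sub>1 = 0\<close>.\<close>

fun rec_poly ::
  "(nat \<Rightarrow> complex) \<Rightarrow> (nat \<Rightarrow> complex) \<Rightarrow> (nat \<Rightarrow> complex) \<Rightarrow> nat \<Rightarrow> complex poly" where
  "rec_poly b a l 0 = 1"
| "rec_poly b a l (Suc 0) = [:- b 0, 1:]"
| "rec_poly b a l (Suc (Suc n)) =
     [:- b (Suc n), 1:] * rec_poly b a l (Suc n) - [:l (Suc n), a (Suc n):] * rec_poly b a l n"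

text \<open>\<open>x\<^sup>n P\<^sub>n(1/x)\<close>. The degree of \<open>P\<^sub>n\<close> is \<open>n\<close>, so this is coefficient reversal;
  see \<open>poly_rec_poly_star\<close> below.\<close>

definition rec_poly_star ::
  "(nat \<Rightarrow> complex) \<Rightarrow> (nat \<Rightarrow> complex) \<Rightarrow> (nat \<Rightarrow> complex) \<Rightarrow> nat \<Rightarrow> complex poly" where
  "rec_poly_star b a l n = reflect_poly (rec_poly b a l n)"

definition seq_shift :: "(nat \<Rightarrow> complex) \<Rightarrow> nat \<Rightarrow> complex" where
  "seq_shift t = (\<lambda>n. t (Suc n))"

definition shifted_rec_poly_star ::
  "nat \<Rightarrow> (nat \<Rightarrow> complex) \<Rightarrow> (nat \<Rightarrow> complex) \<Rightarrow> (nat \<Rightarrow> complex) \<Rightarrow> nat \<Rightarrow> complex poly" where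
  "shifted_rec_poly_star j b a l n =
     rec_poly_star ((seq_shift ^^ j) b) ((seq_shift ^^ j) a) ((seq_shift ^^ j) l) n"

lemma rec_poly_monic: "degree (rec_poly b a l n) = n \<and> lead_coeff (rec_poly b a l n) = 1"
proof (induction b a l n rule: rec_poly.induct)
  case (3 b a l n)
  let ?A = "[:- b (Suc n), 1:] * rec_poly b a l (Suc n)"
  let ?B = "[:l (Suc n), a (Suc n):] * rec_poly b a l n"
  have nz: "rec_poly b a l (Suc n) \<noteq> 0"
    using 3 by auto
  have A: "degree ?A = Suc (Suc n)"
    using 3 nz by (subst degree_mult_eq) auto
  have lA: "lead_coeff ?A = 1"
    using 3 by (subst lead_coeff_mult) auto
  have "degree ?B \<le> degree [:l (Suc n), a (Suc n):] + degree (rec_poly b a l n)"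
    by (rule degree_mult_le)
  also have "\<dots> \<le> 1 + n"
    using 3 by (intro add_mono) auto
  finally have B: "degree ?B < Suc (Suc n)"
    by simp
  have "degree (?A + - ?B) = degree ?A"
    using A B by (intro degree_add_eq_left) (simp only: degree_minus)
  hence d: "degree (?A - ?B) = Suc (Suc n)"
    by (simp only: A diff_conv_add_uminus)
  have "coeff (?A - ?B) (Suc (Suc n)) = 1"
    using lA B unfolding A coeff_diff by (simp only: coeff_eq_0 diff_0_right)
  with d show ?case
    by (simp only: rec_poly.simps)
qed simp_all

lemma poly_rec_poly_star:
  assumes "x \<noteq> 0"
  shows "poly (rec_poly_star b a l n) x = x ^ n * poly (rec_poly b a l n) (1 / x)"
  using assms rec_poly_monic[of b a l n]
  by (simp add: rec_poly_star_def poly_reflect_poly_nz inverse_eq_divide)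


datatype ms_step = Up | Horizontal | Vertical_Down | Diagonal_Down

fun ms_move :: "ms_step \<Rightarrow> int \<times> int \<Rightarrow> int \<times> int" where
  "ms_move Up (x, y) = (x + 1, y + 1)"
| "ms_move Horizontal (x, y) = (x + 1, y)"
| "ms_move Vertical_Down (x, y) = (x, y - 1)"
| "ms_move Diagonal_Down (x, y) = (x + 1, y - 1)"

text \<open>A path is represented by its starting point together with its list of steps.\<close>

fun ms_points :: "int \<times> int \<Rightarrow> ms_step list \<Rightarrow> (int \<times> int) list" where
  "ms_points p [] = [p]"
| "ms_points p (t # w) = p # ms_points (ms_move t p) w"

definition ms_paths :: "int \<times> int \<Rightarrow> int \<times> int \<Rightarrow> ms_step list set" where
  "ms_paths p q = {w. last (ms_points p w) = q \<and> (\<forall>(x, y)\<in>set (ms_points p w). 0 \<le> y)}"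

definition bounded_ms_paths :: "nat \<Rightarrow> int \<times> int \<Rightarrow> int \<times> int \<Rightarrow> ms_step list set" where
  "bounded_ms_paths k p q = {w \<in> ms_paths p q. \<forall>(x, y)\<in>set (ms_points p w). y \<le> int k}"

fun ms_step_weight ::
  "(nat \<Rightarrow> complex) \<Rightarrow> (nat \<Rightarrow> complex) \<Rightarrow> (nat \<Rightarrow> complex) \<Rightarrow> nat \<Rightarrow> ms_step \<Rightarrow> complex" where
  "ms_step_weight b a l h Up = 1"
| "ms_step_weight b a l h Horizontal = b h"
| "ms_step_weight b a l h Vertical_Down = a h"
| "ms_step_weight b a l h Diagonal_Down = l h"

fun ms_weight ::
  "(nat \<Rightarrow> complex) \<Rightarrow> (nat \<Rightarrow> complex) \<Rightarrow> (nat \<Rightarrow> complex) \<Rightarrow>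
     int \<times> int \<Rightarrow> ms_step list \<Rightarrow> complex" where
  "ms_weight b a l p [] = 1"
| "ms_weight b a l p (t # w) =
     ms_step_weight b a l (nat (snd p)) t * ms_weight b a l (ms_move t p) w"

definition bounded_moment ::
  "(nat \<Rightarrow> complex) \<Rightarrow> (nat \<Rightarrow> complex) \<Rightarrow> (nat \<Rightarrow> complex) \<Rightarrow>
     nat \<Rightarrow> nat \<Rightarrow> nat \<Rightarrow> nat \<Rightarrow> complex" where
  "bounded_moment b a l k n r s =
     (\<Sum>w\<in>bounded_ms_paths k (0, int r) (int n, int s). ms_weight b a l (0, int r) w)"

lemma ms_points_nonempty [simp]: "ms_points p w \<noteq> []"
  by (cases w) auto

lemma length_ms_path:
  "int (length w) \<le> 2 * (fst (last (ms_points p w)) - fst p) + (snd p - snd (last (ms_points p w)))"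
proof (induction w arbitrary: p)
  case (Cons t w)
  show ?case
    using Cons.IH[of "ms_move t p"] by (cases t; cases p) auto
qed simp

text \<open>The sum defining \<^const>\<open>bounded_moment\<close> is over a finite set.\<close>

lemma finite_ms_paths: "finite (ms_paths p q)"
proof (rule finite_subset)
  have "(UNIV :: ms_step set) = {Up, Horizontal, Vertical_Down, Diagonal_Down}"
    using ms_step.exhaust by auto
  hence "finite (UNIV :: ms_step set)"
    by (metis finite.emptyI finite.insertI)
  thus "finite {w :: ms_step list. set w \<subseteq> UNIV \<and>
      length w \<le> nat (2 * (fst q - fst p) + (snd p - snd q))}"
    by (rule finite_lists_length_le)
  show "ms_paths p q \<subseteq> {w. set w \<subseteq> UNIV \<and>
      length w \<le> nat (2 * (fst q - fst p) + (snd p - snd q))}"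
  proof
    fix w assume "w \<in> ms_paths p q"
    hence "last (ms_points p w) = q"
      by (simp add: ms_paths_def)
    with length_ms_path[of w p]
    show "w \<in> {w. set w \<subseteq> UNIV \<and> length w \<le> nat (2 * (fst q - fst p) + (snd p - snd q))}"
      by auto
  qed
qed

lemma finite_bounded_ms_paths: "finite (bounded_ms_paths k p q)"
  using finite_ms_paths[of p q] by (simp add: bounded_ms_paths_def)

end

theory Submission
  imports Defs
begin

text \<open>Decomposing a path at its first step shows that the generating functions
  \<open>F\<^sub>r = \<Sum>\<^sub>n \<mu>\<^sub>n\<^sub>,\<^sub>r\<^sub>,\<^sub>s x\<^sup>n\<close>, for fixed \<open>s\<close> and \<open>k\<close>, solve the tridiagonal linear system
  \<open>(1 - b\<^sub>r x) F\<^sub>r - x F\<^sub>r\<^sub>+\<^sub>1 - (a\<^sub>r + \<lambda>\<^sub>r x) F\<^sub>r\<^sub>-\<^sub>1 = [r = s]\<close>, \<open>0 \<le> r \<le> k\<close>.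
  The determinants of the diagonal blocks of such a matrix are continuants; they satisfy the
  three-term recurrence of the reversed polynomials, so the block on the heights
  \<open>j, \<dots>, j + n - 1\<close> has determinant \<open>\<delta>\<^sup>jP\<^sup>*\<^sub>n\<close>. The entries of the adjugate matrix are products
  of two continuants and of the off-diagonal entries between them, and the claim is Cramer's
  rule. The product of the adjugate with the matrix is computed off the diagonal by expanding
  a continuant at its first or last index, and on the diagonal by Euler's identity, which
  expands it at an inner index.\<close>

text \<open>The determinant of the tridiagonal matrix with rows and columns \<open>i, \<dots>, i + n - 1\<close>
  whose entries at \<open>(j, j)\<close>, \<open>(j, j + 1)\<close> and \<open>(j + 1, j)\<close> are \<open>\<beta> j\<close>, \<open>- \<alpha> j\<close> and \<open>- \<gamma> j\<close>.\<close>

fun continuant ::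
  "(nat \<Rightarrow> 'a) \<Rightarrow> (nat \<Rightarrow> 'a) \<Rightarrow> (nat \<Rightarrow> 'a) \<Rightarrow> nat \<Rightarrow> nat \<Rightarrow> 'a :: comm_ring_1" where
  "continuant \<alpha> \<beta> \<gamma> i 0 = 1"
| "continuant \<alpha> \<beta> \<gamma> i (Suc 0) = \<beta> i"
| "continuant \<alpha> \<beta> \<gamma> i (Suc (Suc n)) =
     \<beta> (i + Suc n) * continuant \<alpha> \<beta> \<gamma> i (Suc n)
     - \<alpha> (i + n) * \<gamma> (i + n) * continuant \<alpha> \<beta> \<gamma> i n"

lemma continuant_add:
  "continuant \<alpha> \<beta> \<gamma> i (Suc m + Suc n) =
     continuant \<alpha> \<beta> \<gamma> i (Suc m) * continuant \<alpha> \<beta> \<gamma> (i + Suc m) (Suc n)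
     - \<alpha> (i + m) * \<gamma> (i + m) * continuant \<alpha> \<beta> \<gamma> i m * continuant \<alpha> \<beta> \<gamma> (i + Suc (Suc m)) n"
proof (induction n rule: induct_nat_012)
  case (ge2 n)
  have "continuant \<alpha> \<beta> \<gamma> i (Suc m + Suc (Suc (Suc n))) =
      \<beta> (i + Suc m + Suc (Suc n)) * continuant \<alpha> \<beta> \<gamma> i (Suc m + Suc (Suc n))
      - \<alpha> (i + Suc m + Suc n) * \<gamma> (i + Suc m + Suc n) * continuant \<alpha> \<beta> \<gamma> i (Suc m + Suc n)"
    by (simp add: ac_simps)
  then show ?case
    unfolding ge2 by (simp add: algebra_simps)
qed (simp_all add: algebra_simps)

lemma continuant_Suc_Suc_left:
  "continuant \<alpha> \<beta> \<gamma> i (Suc (Suc n)) =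
     \<beta> i * continuant \<alpha> \<beta> \<gamma> (Suc i) (Suc n)
     - \<alpha> i * \<gamma> i * continuant \<alpha> \<beta> \<gamma> (Suc (Suc i)) n"
  using continuant_add[of \<alpha> \<beta> \<gamma> i 0 n] by simp

definition tridiagonal_mult ::
  "(nat \<Rightarrow> 'a) \<Rightarrow> (nat \<Rightarrow> 'a) \<Rightarrow> (nat \<Rightarrow> 'a) \<Rightarrow> nat \<Rightarrow> (nat \<Rightarrow> 'a) \<Rightarrow> nat \<Rightarrow> 'a :: comm_ring_1" where
  "tridiagonal_mult \<alpha> \<beta> \<gamma> k F r =
     \<beta> r * F r - (if r < k then \<alpha> r * F (Suc r) else 0)
     - (case r of 0 \<Rightarrow> 0 | Suc i \<Rightarrow> \<gamma> i * F i)"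

definition tridiagonal_adjugate ::
  "(nat \<Rightarrow> 'a) \<Rightarrow> (nat \<Rightarrow> 'a) \<Rightarrow> (nat \<Rightarrow> 'a) \<Rightarrow> nat \<Rightarrow> nat \<Rightarrow> nat \<Rightarrow> 'a :: comm_ring_1" where
  "tridiagonal_adjugate \<alpha> \<beta> \<gamma> k r s =
     (if r \<le> s
      then continuant \<alpha> \<beta> \<gamma> 0 r * continuant \<alpha> \<beta> \<gamma> (Suc s) (k - s) * prod \<alpha> {r..<s}
      else continuant \<alpha> \<beta> \<gamma> 0 s * continuant \<alpha> \<beta> \<gamma> (Suc r) (k - r) * prod \<gamma> {s..<r})"

lemma sum_tridiagonal_mult_adjoint:
  "(\<Sum>s\<le>k. G s * tridiagonal_mult \<alpha> \<beta> \<gamma> k F s) = (\<Sum>s\<le>k. tridiagonal_mult \<gamma> \<beta> \<alpha> k G s * F s)"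
proof -
  have upper: "(\<Sum>s\<le>k. if s < k then f s else 0) = sum f {..<k}" for f :: "nat \<Rightarrow> 'a"
    by (simp add: lessThan_Suc_atMost[symmetric])
  have lower: "(\<Sum>s\<le>k. case s of 0 \<Rightarrow> 0 | Suc i \<Rightarrow> f i) = sum f {..<k}" for f :: "nat \<Rightarrow> 'a"
    by (simp add: lessThan_Suc_atMost[symmetric] sum.lessThan_Suc_shift del: sum.lessThan_Suc)
  have expand: "(\<Sum>s\<le>k. H s * tridiagonal_mult \<alpha> \<beta> \<gamma> k F s) =
      (\<Sum>s\<le>k. \<beta> s * F s * H s) - (\<Sum>s<k. \<alpha> s * F (Suc s) * H s) - (\<Sum>s<k. \<gamma> s * F s * H (Suc s))"
    for \<alpha> \<gamma> F H :: "nat \<Rightarrow> 'a"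
  proof -
    have "H s * tridiagonal_mult \<alpha> \<beta> \<gamma> k F s = \<beta> s * F s * H s
        - (if s < k then \<alpha> s * F (Suc s) * H s else 0)
        - (case s of 0 \<Rightarrow> 0 | Suc i \<Rightarrow> \<gamma> i * F i * H (Suc i))" for s
      by (simp add: tridiagonal_mult_def algebra_simps split: nat.split)
    then show ?thesis
      by (simp only: sum_subtractf upper lower)
  qed
  show ?thesis
    using expand[of G \<alpha> \<gamma> F] expand[of F \<gamma> \<alpha> G] by (simp add: ac_simps)
qed

lemma tridiagonal_adjugate_le:
  "r \<le> s \<Longrightarrow> tridiagonal_adjugate \<alpha> \<beta> \<gamma> k r s =
     continuant \<alpha> \<beta> \<gamma> 0 r * continuant \<alpha> \<beta> \<gamma> (Suc s) (k - s) * prod \<alpha> {r..<s}"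
  by (simp add: tridiagonal_adjugate_def)

lemma tridiagonal_adjugate_ge:
  "s \<le> r \<Longrightarrow> tridiagonal_adjugate \<alpha> \<beta> \<gamma> k r s =
     continuant \<alpha> \<beta> \<gamma> 0 s * continuant \<alpha> \<beta> \<gamma> (Suc r) (k - r) * prod \<gamma> {s..<r}"
  by (auto simp: tridiagonal_adjugate_def)

lemma tridiagonal_mult_adjugate_row_less:
  assumes "r < s" "s \<le> k"
  shows "tridiagonal_mult \<gamma> \<beta> \<alpha> k (tridiagonal_adjugate \<alpha> \<beta> \<gamma> k r) s = 0"
proof -
  obtain t where s: "s = Suc t" "r \<le> t"
    using \<open>r < s\<close> by (cases s) auto
  obtain n where k: "k = s + n"
    using \<open>s \<le> k\<close> le_iff_add by blast
  show ?thesis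
  proof (cases n)
    case 0
    then show ?thesis
      using s k by (simp add: tridiagonal_mult_def tridiagonal_adjugate_le)
  next
    case (Suc m)
    then show ?thesis
      using s k by (simp add: tridiagonal_mult_def tridiagonal_adjugate_le Suc_diff_le
          continuant_Suc_Suc_left algebra_simps del: continuant.simps(3))
  qed
qed

lemma tridiagonal_mult_adjugate_row_greater:
  assumes "s < r" "r \<le> k"
  shows "tridiagonal_mult \<gamma> \<beta> \<alpha> k (tridiagonal_adjugate \<alpha> \<beta> \<gamma> k r) s = 0"
proof (cases s)
  case 0
  then show ?thesis
    using assms by (simp add: tridiagonal_mult_def tridiagonal_adjugate_ge
        prod.atLeast_Suc_lessThan[of 0] del: prod.op_ivl_Suc)
next
  case (Suc t)
  have "prod \<gamma> {t..<r} = \<gamma> t * (\<gamma> s * prod \<gamma> {Suc s..<r})"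
    "prod \<gamma> {s..<r} = \<gamma> s * prod \<gamma> {Suc s..<r}"
    using assms Suc by (simp_all add: prod.atLeast_Suc_lessThan)
  then show ?thesis
    using assms Suc by (simp add: tridiagonal_mult_def tridiagonal_adjugate_ge algebra_simps)
qed

lemma tridiagonal_mult_adjugate_row_diag:
  assumes "r \<le> k"
  shows "tridiagonal_mult \<gamma> \<beta> \<alpha> k (tridiagonal_adjugate \<alpha> \<beta> \<gamma> k r) r = continuant \<alpha> \<beta> \<gamma> 0 (Suc k)"
proof -
  let ?K = "continuant \<alpha> \<beta> \<gamma>"
  obtain n where k: "k = r + n"
    using \<open>r \<le> k\<close> le_iff_add by blast
  have head: "?K 0 (Suc r) = \<beta> r * ?K 0 r - (case r of 0 \<Rightarrow> 0 | Suc i \<Rightarrow> \<alpha> i * \<gamma> i * ?K 0 i)"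
    by (cases r) simp_all
  have "?K 0 (Suc k) = ?K 0 (Suc r) * ?K (Suc r) n
      - (case n of 0 \<Rightarrow> 0 | Suc m \<Rightarrow> \<alpha> r * \<gamma> r * ?K 0 r * ?K (Suc (Suc r)) m)"
    using k continuant_add[of \<alpha> \<beta> \<gamma> 0 r "n - 1"] by (cases n) (simp_all del: continuant.simps(3))
  also have "\<dots> = tridiagonal_mult \<gamma> \<beta> \<alpha> k (tridiagonal_adjugate \<alpha> \<beta> \<gamma> k r) r"
    unfolding head using k
    by (simp add: tridiagonal_mult_def tridiagonal_adjugate_le tridiagonal_adjugate_ge
        algebra_simps split: nat.split)
  finally show ?thesis ..
qed

lemma tridiagonal_cramer:
  assumes "r \<le> k"
  shows "continuant \<alpha> \<beta> \<gamma> 0 (Suc k) * F r =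
    (\<Sum>s\<le>k. tridiagonal_adjugate \<alpha> \<beta> \<gamma> k r s * tridiagonal_mult \<alpha> \<beta> \<gamma> k F s)"
proof -
  have "tridiagonal_mult \<gamma> \<beta> \<alpha> k (tridiagonal_adjugate \<alpha> \<beta> \<gamma> k r) s =
      (if s = r then continuant \<alpha> \<beta> \<gamma> 0 (Suc k) else 0)" if "s \<le> k" for s
    using that assms tridiagonal_mult_adjugate_row_less[of r s k \<gamma> \<beta> \<alpha>]
      tridiagonal_mult_adjugate_row_greater[of s r k \<gamma> \<beta> \<alpha>]
      tridiagonal_mult_adjugate_row_diag[of r k \<gamma> \<beta> \<alpha>]
    by (metis linorder_neqE_nat)
  then have "(\<Sum>s\<le>k. tridiagonal_mult \<gamma> \<beta> \<alpha> k (tridiagonal_adjugate \<alpha> \<beta> \<gamma> k r) s * F s) =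
      (\<Sum>s\<le>k. if s = r then continuant \<alpha> \<beta> \<gamma> 0 (Suc k) * F s else 0)"
    by (intro sum.cong) auto
  also have "\<dots> = continuant \<alpha> \<beta> \<gamma> 0 (Suc k) * F r"
    using assms by simp
  finally show ?thesis
    by (simp only: sum_tridiagonal_mult_adjoint)
qed

lemma poly_eqI_infinite:
  fixes p q :: "'a :: idom poly"
  assumes "infinite A" "\<And>x. x \<in> A \<Longrightarrow> poly p x = poly q x"
  shows "p = q"
proof -
  have "A \<subseteq> {x. poly (p - q) x = 0}"
    using assms(2) by auto
  then have "p - q = 0"
    using \<open>infinite A\<close> poly_roots_finite[of "p - q"] finite_subset by blast
  then show ?thesis by simp
qed

lemma rec_poly_star_eqI:
  assumes "\<And>x. x \<noteq> 0 \<Longrightarrow> poly p x = x ^ n * poly (rec_poly b a l n) (1 / x)"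
  shows "rec_poly_star b a l n = p"
proof (rule poly_eqI_infinite)
  show "infinite (- {0 :: complex})"
    by (simp add: infinite_UNIV_char_0 finite_compl)
qed (simp add: assms poly_rec_poly_star)

lemma rec_poly_star_0: "rec_poly_star b a l 0 = 1"
  by (simp add: rec_poly_star_def)

lemma rec_poly_star_1: "rec_poly_star b a l (Suc 0) = [:1, - b 0:]"
  by (rule rec_poly_star_eqI) (simp add: field_simps)

lemma rec_poly_star_Suc_Suc:
  "rec_poly_star b a l (Suc (Suc n)) =
     [:1, - b (Suc n):] * rec_poly_star b a l (Suc n)
     - [:0, a (Suc n), l (Suc n):] * rec_poly_star b a l n"
  by (rule rec_poly_star_eqI) (simp add: poly_rec_poly_star field_simps)

definition diagonal_fps :: "(nat \<Rightarrow> complex) \<Rightarrow> nat \<Rightarrow> complex fps" where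
  "diagonal_fps b i = 1 - fps_const (b i) * fps_X"

text \<open>The index is the height at which the down step ends.\<close>

definition down_fps :: "(nat \<Rightarrow> complex) \<Rightarrow> (nat \<Rightarrow> complex) \<Rightarrow> nat \<Rightarrow> complex fps" where
  "down_fps a l i = fps_const (a (Suc i)) + fps_const (l (Suc i)) * fps_X"

abbreviation ms_continuant ::
  "(nat \<Rightarrow> complex) \<Rightarrow> (nat \<Rightarrow> complex) \<Rightarrow> (nat \<Rightarrow> complex) \<Rightarrow> nat \<Rightarrow> nat \<Rightarrow> complex fps" where
  "ms_continuant b a l \<equiv> continuant (\<lambda>_. fps_X) (diagonal_fps b) (down_fps a l)"

lemma ms_continuant_nth_0: "ms_continuant b a l i n $ 0 = 1"
  by (induction n rule: induct_nat_012) (simp_all add: diagonal_fps_def mult.assoc)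

lemma seq_shift_funpow: "(seq_shift ^^ j) t n = t (j + n)"
  by (induction j arbitrary: n) (simp_all add: seq_shift_def)

lemma fps_of_poly_shifted_rec_poly_star:
  "fps_of_poly (shifted_rec_poly_star j b a l n) = ms_continuant b a l j n"
proof -
  have diag: "fps_of_poly [:1, - b i:] = diagonal_fps b i" for i
    by (simp add: diagonal_fps_def fps_of_poly_linear' flip: fps_const_neg)
  have down: "fps_of_poly [:0, a (Suc i), l (Suc i):] = fps_X * down_fps a l i" for i
    by (simp add: down_fps_def fps_of_poly_pCons algebra_simps)
  show ?thesis
  proof (induction n rule: induct_nat_012)
    case 0
    show ?case
      by (simp add: shifted_rec_poly_star_def rec_poly_star_0)
  next
    case 1
    show ?case
      by (simp add: shifted_rec_poly_star_def rec_poly_star_1 seq_shift_funpow diag)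
  next
    case (ge2 n)
    then show ?case
      by (simp add: shifted_rec_poly_star_def rec_poly_star_Suc_Suc seq_shift_funpow diag down
          fps_of_poly_diff fps_of_poly_mult del: mult_pCons_left)
  qed
qed

lemma fps_of_poly_rec_poly_star: "fps_of_poly (rec_poly_star b a l n) = ms_continuant b a l 0 n"
  using fps_of_poly_shifted_rec_poly_star[of 0] by (simp add: shifted_rec_poly_star_def)

lemma Nil_mem_bounded_ms_paths_iff:
  "[] \<in> bounded_ms_paths k p q \<longleftrightarrow> 0 \<le> snd p \<and> snd p \<le> int k \<and> p = q"
  by (auto simp: bounded_ms_paths_def ms_paths_def case_prod_beta)

lemma Cons_mem_bounded_ms_paths_iff:
  "t # w \<in> bounded_ms_paths k p q \<longleftrightarrow>
     0 \<le> snd p \<and> snd p \<le> int k \<and> w \<in> bounded_ms_paths k (ms_move t p) q"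
  by (auto simp: bounded_ms_paths_def ms_paths_def case_prod_beta)

lemma start_le_end_bounded_ms_path: "w \<in> bounded_ms_paths k p q \<Longrightarrow> fst p \<le> fst q"
proof (induction w arbitrary: p)
  case (Cons t w)
  then have "fst (ms_move t p) \<le> fst q"
    by (simp add: Cons_mem_bounded_ms_paths_iff)
  then show ?case
    by (cases t; cases p) auto
qed (simp add: Nil_mem_bounded_ms_paths_iff)

lemma ms_move_translate:
  "ms_move t (x + d, y) = (fst (ms_move t (x, y)) + d, snd (ms_move t (x, y)))"
  by (cases t) simp_all

lemma mem_bounded_ms_paths_translate:
  "w \<in> bounded_ms_paths k (x + d, y) (x' + d, y') \<longleftrightarrow> w \<in> bounded_ms_paths k (x, y) (x', y')"
proof (induction w arbitrary: x y)
  case (Cons t w)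
  then show ?case
    by (simp only: Cons_mem_bounded_ms_paths_iff ms_move_translate snd_conv prod.collapse)
qed (simp add: Nil_mem_bounded_ms_paths_iff)

lemma ms_weight_translate: "ms_weight b a l (x + d, y) w = ms_weight b a l (x, y) w"
proof (induction w arbitrary: x y)
  case (Cons t w)
  then show ?case
    by (simp only: ms_weight.simps ms_move_translate snd_conv prod.collapse)
qed simp

definition bounded_weight_sum ::
  "(nat \<Rightarrow> complex) \<Rightarrow> (nat \<Rightarrow> complex) \<Rightarrow> (nat \<Rightarrow> complex) \<Rightarrow>
     nat \<Rightarrow> int \<times> int \<Rightarrow> int \<times> int \<Rightarrow> complex" where
  "bounded_weight_sum b a l k p q = (\<Sum>w\<in>bounded_ms_paths k p q. ms_weight b a l p w)"

lemma bounded_weight_sum_translate: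
  "bounded_weight_sum b a l k (x + d, y) (x' + d, y') = bounded_weight_sum b a l k (x, y) (x', y')"
proof -
  have "bounded_ms_paths k (x + d, y) (x' + d, y') = bounded_ms_paths k (x, y) (x', y')"
    using mem_bounded_ms_paths_translate by blast
  then show ?thesis
    by (simp add: bounded_weight_sum_def ms_weight_translate)
qed

lemma bounded_weight_sum_eq_0_backwards: "fst q < fst p \<Longrightarrow> bounded_weight_sum b a l k p q = 0"
  unfolding bounded_weight_sum_def using start_le_end_bounded_ms_path
  by (intro sum.neutral) fastforce

lemma bounded_weight_sum_eq_0_outside:
  assumes "snd p < 0 \<or> snd p > int k"
  shows "bounded_weight_sum b a l k p q = 0"
proof -
  have "w \<notin> bounded_ms_paths k p q" for w
    using assms
    by (cases w) (auto simp: Nil_mem_bounded_ms_paths_iff Cons_mem_bounded_ms_paths_iff)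
  then have "bounded_ms_paths k p q = {}"
    by blast
  then show ?thesis
    by (simp add: bounded_weight_sum_def)
qed

lemma UNIV_ms_step: "UNIV = {Up, Horizontal, Vertical_Down, Diagonal_Down}"
  using ms_step.exhaust by auto

lemma bounded_weight_sum_first_step:
  assumes "0 \<le> snd p" "snd p \<le> int k"
  shows "bounded_weight_sum b a l k p q = (if p = q then 1 else 0)
    + (\<Sum>t\<in>UNIV. ms_step_weight b a l (nat (snd p)) t * bounded_weight_sum b a l k (ms_move t p) q)"
proof -
  let ?W = "ms_weight b a l p"
  let ?S = "SIGMA t:UNIV. bounded_ms_paths k (ms_move t p) q"
  have paths: "bounded_ms_paths k p q = (if p = q then {[]} else {}) \<union> (\<lambda>(t, w). t # w) ` ?S"
  proof (rule set_eqI)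
    fix w show "w \<in> bounded_ms_paths k p q \<longleftrightarrow>
        w \<in> (if p = q then {[]} else {}) \<union> (\<lambda>(t, w). t # w) ` ?S"
      using assms
      by (cases w) (auto simp: Nil_mem_bounded_ms_paths_iff Cons_mem_bounded_ms_paths_iff image_iff)
  qed
  have finite_steps: "finite (UNIV :: ms_step set)" and finite_S: "finite ?S"
    by (simp_all add: UNIV_ms_step finite_bounded_ms_paths)
  have "bounded_weight_sum b a l k p q =
      sum ?W (if p = q then {[]} else {}) + sum ?W ((\<lambda>(t, w). t # w) ` ?S)"
    unfolding bounded_weight_sum_def paths
    by (rule sum.union_disjoint) (use finite_S in auto)
  also have "sum ?W ((\<lambda>(t, w). t # w) ` ?S) =
      (\<Sum>(t, w)\<in>?S. ms_step_weight b a l (nat (snd p)) t * ms_weight b a l (ms_move t p) w)"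
    by (subst sum.reindex) (auto simp: inj_on_def intro!: sum.cong)
  also have "\<dots> =
      (\<Sum>t\<in>UNIV. ms_step_weight b a l (nat (snd p)) t * bounded_weight_sum b a l k (ms_move t p) q)"
    by (simp add: bounded_weight_sum_def sum_distrib_left finite_steps finite_bounded_ms_paths
        flip: sum.Sigma)
  finally show ?thesis
    by simp
qed

definition bounded_moment_fps ::
  "(nat \<Rightarrow> complex) \<Rightarrow> (nat \<Rightarrow> complex) \<Rightarrow> (nat \<Rightarrow> complex) \<Rightarrow> nat \<Rightarrow> nat \<Rightarrow> nat \<Rightarrow> complex fps" where
  "bounded_moment_fps b a l k s r = Abs_fps (\<lambda>n. bounded_moment b a l k n r s)"

lemma bounded_moment_fps_nth:
  "bounded_moment_fps b a l k s r $ n = bounded_weight_sum b a l k (0, int r) (int n, int s)"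
  by (simp add: bounded_moment_fps_def bounded_moment_def bounded_weight_sum_def)

lemma fps_X_mult_bounded_moment_fps_nth:
  "(fps_X * bounded_moment_fps b a l k s r) $ n =
     bounded_weight_sum b a l k (1, int r) (int n, int s)"
proof (cases n)
  case 0
  then show ?thesis
    by (simp add: bounded_weight_sum_eq_0_backwards)
next
  case (Suc m)
  then show ?thesis
    using bounded_weight_sum_translate[of b a l k 0 1 "int r" "int m" "int s"]
    by (simp add: bounded_moment_fps_nth add.commute)
qed

lemma tridiagonal_mult_bounded_moment_fps:
  assumes "r \<le> k"
  shows "tridiagonal_mult (\<lambda>_. fps_X) (diagonal_fps b) (down_fps a l) k
    (bounded_moment_fps b a l k s) r = (if r = s then 1 else 0)"
proof (rule fps_ext)
  fix n
  let ?M = "bounded_moment_fps b a l k s"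
  let ?W = "\<lambda>x h. bounded_weight_sum b a l k (x, h) (int n, int s)"
  have up: "(if r < k then fps_X * ?M (Suc r) else 0) $ n = ?W 1 (int r + 1)"
    using assms
    by (auto simp: fps_X_mult_bounded_moment_fps_nth bounded_weight_sum_eq_0_outside add.commute
        simp del: fps_X_mult_nth)
  have horizontal: "(diagonal_fps b r * ?M r) $ n = ?W 0 (int r) - b r * ?W 1 (int r)"
    by (simp add: diagonal_fps_def left_diff_distrib mult.assoc bounded_moment_fps_nth
        fps_X_mult_bounded_moment_fps_nth del: fps_X_mult_nth)
  have down: "(case r of 0 \<Rightarrow> 0 | Suc i \<Rightarrow> down_fps a l i * ?M i) $ n =
      a r * ?W 0 (int r - 1) + l r * ?W 1 (int r - 1)"
    by (cases r) (simp_all add: down_fps_def distrib_right mult.assoc bounded_moment_fps_nth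
        fps_X_mult_bounded_moment_fps_nth bounded_weight_sum_eq_0_outside del: fps_X_mult_nth)
  have "?W 0 (int r) = (if r = s \<and> n = 0 then 1 else 0) + (?W 1 (int r + 1)
      + b r * ?W 1 (int r) + a r * ?W 0 (int r - 1) + l r * ?W 1 (int r - 1))"
    using bounded_weight_sum_first_step[of "(0, int r)" k b a l "(int n, int s)"] assms
    by (simp add: UNIV_ms_step add_ac conj_commute)
  then show "tridiagonal_mult (\<lambda>_. fps_X) (diagonal_fps b) (down_fps a l) k ?M r $ n =
      (if r = s then 1 else 0) $ n"
    by (simp add: tridiagonal_mult_def up horizontal down)
qed

lemma bounded_moment_fps_eq:
  assumes "r \<le> k" "s \<le> k"
  shows "bounded_moment_fps b a l k s r =
    tridiagonal_adjugate (\<lambda>_. fps_X) (diagonal_fps b) (down_fps a l) k r s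
    / ms_continuant b a l 0 (Suc k)"
proof -
  have "ms_continuant b a l 0 (Suc k) \<noteq> 0"
    using ms_continuant_nth_0[of b a l 0 "Suc k"] by force
  moreover have "ms_continuant b a l 0 (Suc k) * bounded_moment_fps b a l k s r =
      tridiagonal_adjugate (\<lambda>_. fps_X) (diagonal_fps b) (down_fps a l) k r s"
    unfolding tridiagonal_cramer[OF \<open>r \<le> k\<close>]
    using \<open>s \<le> k\<close> by (simp add: tridiagonal_mult_bounded_moment_fps mult_delta_right)
  ultimately show ?thesis
    by (metis nonzero_mult_div_cancel_left)
qed

theorem theorem5p3:
  fixes b a l :: "nat \<Rightarrow> complex" and r s k :: nat
  assumes "r \<le> k" and "s \<le> k"
  shows "(r \<le> s \<longrightarrow>
           Abs_fps (\<lambda>n. bounded_moment b a l k n r s) =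
             fps_of_poly (rec_poly_star b a l r)
               * fps_of_poly (shifted_rec_poly_star (s + 1) b a l (k - s))
               / fps_of_poly (rec_poly_star b a l (k + 1)) * fps_X ^ (s - r)) \<and>
         (r > s \<longrightarrow>
           Abs_fps (\<lambda>n. bounded_moment b a l k n r s) =
             fps_of_poly (rec_poly_star b a l s)
               * fps_of_poly (shifted_rec_poly_star (r + 1) b a l (k - r))
               / fps_of_poly (rec_poly_star b a l (k + 1))
               * (\<Prod>i=s+1..r. fps_const (a i) + fps_const (l i) * fps_X))"
proof -
  let ?K = "ms_continuant b a l"
  have unit: "?K 0 (Suc k) $ 0 \<noteq> 0"
    by (simp add: ms_continuant_nth_0 del: continuant.simps)
  have down: "(\<Prod>i=s+1..r. fps_const (a i) + fps_const (l i) * fps_X) = prod (down_fps a l) {s..<r}"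
    by (simp add: down_fps_def prod.shift_bounds_Suc_ivl atLeastLessThanSuc_atLeastAtMost[symmetric]
        del: prod.op_ivl_Suc)
  have adjugate: "Abs_fps (\<lambda>n. bounded_moment b a l k n r s) =
      tridiagonal_adjugate (\<lambda>_. fps_X) (diagonal_fps b) (down_fps a l) k r s / ?K 0 (Suc k)"
    using bounded_moment_fps_eq[OF assms] by (simp add: bounded_moment_fps_def)
  show ?thesis
    unfolding adjugate down fps_of_poly_rec_poly_star fps_of_poly_shifted_rec_poly_star
    using unit by (simp add: tridiagonal_adjugate_def fps_divide_unit mult_ac del: continuant.simps)
qed

end
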